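(* Let $t$ be an even nonnegative integer and let $C$ be an orthogonal array OA$(N,n,2,t)$ such that $$N = 2^n\left(1-\frac{n+1}{2(t+2)}\right).$$ Put $C'=C+\bar 1=\{\bar c+\bar 1 : \bar c\in C\}$ and $C''=\{0,1\}^n\setminus (C\cup C')$. Then $(C,C',C'')$ is an equitable partition of the $n$-cube $Q_n$ with quotient matrix $$\begin{pmatrix} 0 & 2t-n+2 & 2n-2t-2\\ 2t-n+2 & 0 & 2n-2t-2\\ 2t-n+3 & 2t-n+3 & 3n-4t-6\end{pmatrix}=\begin{pmatrix} 0 & a & n-a\\ a & 0 & n-a\\ a+1 & a+1 & n-2a-2\end{pmatrix},\qquad a=2t-n+2.$$
   Context: The $n$-cube $Q_n$ is the graph with vertex set $\{0,1\}^n$ in which two words are adjacent iff they differ in exactly one coordinate; vertices are added coordinatewise modulo 2, and $\bar 1$ is the all-one word. A (binary) orthogonal array OA$(N,n,2,t)$ is a multiset $C$ of $N$ elements of $\{0,1\}^n$ such that every subcube obtained by fixing the values of $t$ coordinates (i.e. every subgraph of $Q_n$ isomorphic to $Q_{n-t}$) contains exactly $N/2^t$ elements of $C$, counted with multiplicity. A partition $(C_0,\ldots,C_{k-1})$ of the vertex set of a graph is an equitable partition with quotient matrix $S=(s_{ij})$ if for all $i,j$ every vertex of $C_i$ has exactly $s_{ij}$ neighbors in $C_j$. Cells are allowed to be empty (the condition for an empty cell $C_i$ is vacuous). *)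

theory Defs
  imports
    Complex_Main
    "HOL-Library.Multiset"
    "HOL-Library.Disjoint_Sets"
    "HOL-Library.Z2"
    "Jordan_Normal_Form.Matrix"
    "Graph_Theory.Graph_Theory"
begin

text \<open>
  Binary words of length \<open>n\<close> are the elements of \<open>carrier_vec n :: bit vec set\<close>, so that
  vector addition is coordinatewise addition modulo 2.
\<close>

definition cube :: "nat \<Rightarrow> bit vec pair_pre_digraph" where
  "cube n = \<lparr>pverts = carrier_vec n,
             parcs = {(v, w). v \<in> carrier_vec n \<and> w \<in> carrier_vec n \<and>
                              card {i. i < n \<and> v $ i \<noteq> w $ i} = 1}\<rparr>"

definition all_one :: "nat \<Rightarrow> bit vec" where
  "all_one n = vec n (\<lambda>_. 1)"

text \<open>The subcube obtained by fixing the coordinates in \<open>I\<close> to the values given by \<open>b\<close>.\<close>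

definition subcube :: "nat \<Rightarrow> nat set \<Rightarrow> (nat \<Rightarrow> bit) \<Rightarrow> bit vec set" where
  "subcube n I b = {x \<in> carrier_vec n. \<forall>i\<in>I. x $ i = b i}"

text \<open>
  The array \<open>C\<close> is an OA$(N,n,2,t)$. The condition \<open>t \<le> n\<close> is part of the notion (otherwise
  there are no \<open>t\<close> coordinates to fix, and every multiset would qualify). The size of
  \<open>filter_mset\<close> counts elements with multiplicity.
\<close>

definition orthogonal_array :: "nat \<Rightarrow> nat \<Rightarrow> nat \<Rightarrow> bit vec multiset \<Rightarrow> bool" where
  "orthogonal_array N n t C \<longleftrightarrow>
     t \<le> n \<and> set_mset C \<subseteq> carrier_vec n \<and> size C = N \<and>
     (\<forall>I b. I \<subseteq> {..<n} \<and> card I = t \<longrightarrow>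
        real (size (filter_mset (\<lambda>x. x \<in> subcube n I b) C)) = real N / 2 ^ t)"

text \<open>
  The cells are indexed by their position in the list \<open>Cs\<close>; they may be empty, hence the
  indexed notion of disjointness. The entries of the quotient matrix are integers rather than
  natural numbers, because a row that belongs to an empty cell is unconstrained and may
  contain negative entries. Meant for finite graphs, since \<open>card\<close> counts the neighbours.
\<close>

definition equitable_partition :: "'a pair_pre_digraph \<Rightarrow> 'a set list \<Rightarrow> int mat \<Rightarrow> bool" where
  "equitable_partition G Cs S \<longleftrightarrow>
     S \<in> carrier_mat (length Cs) (length Cs) \<and>
     (\<Union>i<length Cs. Cs ! i) = pverts G \<and>
     disjoint_family_on (\<lambda>i. Cs ! i) {..<length Cs} \<and>
     (\<forall>i<length Cs. \<forall>j<length Cs. \<forall>v \<in> Cs ! i.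
        int (card {w \<in> Cs ! j. (v, w) \<in> parcs G}) = S $$ (i, j))"

lemma finite_carrier_vec_bit: "finite (carrier_vec n :: bit vec set)"
proof (rule finite_subset)
  show "(carrier_vec n :: bit vec set) \<subseteq> vec_of_list ` {xs. set xs \<subseteq> {0, 1} \<and> length xs = n}"
  proof
    fix v :: "bit vec" assume v: "v \<in> carrier_vec n"
    have "set (list_of_vec v) \<subseteq> {0, 1}" by (metis bit_not_one_iff insertCI subsetI)
    moreover have "length (list_of_vec v) = n" using v by simp
    ultimately show "v \<in> vec_of_list ` {xs. set xs \<subseteq> {0, 1} \<and> length xs = n}"
      by (intro image_eqI[where x = "list_of_vec v"]) (auto simp: vec_list)
  qed
  show "finite (vec_of_list ` {xs :: bit list. set xs \<subseteq> {0, 1} \<and> length xs = n})"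
    by (intro finite_imageI finite_lists_length_eq) simp
qed

lemma pair_graph_cube: "pair_graph (cube n)"
proof
  show "finite (parcs (cube n))"
    by (rule finite_subset[of _ "carrier_vec n \<times> carrier_vec n"])
      (auto simp: cube_def finite_carrier_vec_bit)
  show "symmetric (with_proj (cube n))"
  proof -
    have "{i. i < n \<and> v $ i \<noteq> w $ i} = {i. i < n \<and> w $ i \<noteq> v $ i}" for v w :: "bit vec"
      by auto
    then show ?thesis
      by (auto simp: symmetric_def cube_def intro!: symI)
  qed
qed (auto simp: cube_def finite_carrier_vec_bit)

end

theory Submission
  imports Defs
begin

text \<open>
  Let \<open>f\<close> be the multiplicity function of \<open>C\<close>, and write \<open>b = a + 1 = 2t - n + 3\<close>. The idea is to
  add to the edges of the \<open>n\<close>-cube an edge from every word to its complement, which gives the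
  folded \<open>(n+1)\<close>-cube, regular of degree \<open>n + 1\<close>. If the non-constant part of a multiset of vertices
  is spanned by eigenvectors of eigenvalue at most \<open>-b\<close>, then a spectral estimate bounds its density
  from below by \<open>b / (n + 1 + b)\<close> (the bound of Bierbrauer and Friedman). \<open>C\<close> attains this bound, and
  equality is rigid enough to give everything at once.

  The Walsh functions \<open>walsh S\<close> are eigenvectors of the folded adjacency operator \<open>B\<close>, with
  eigenvalue \<open>n - 2|S| + (-1)^|S|\<close> (lemma \<open>walsh_transform_folded_adjacency\<close>). Strength \<open>t\<close> makes
  the Walsh coefficients of \<open>f\<close> vanish for \<open>1 \<le> |S| \<le> t\<close> (lemma
  \<open>orthogonal_array_walsh_transform\<close>). Here the parity of \<open>t\<close> enters: the sizes \<open>t + 1\<close> (odd) and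
  \<open>t + 2\<close> (even) have the same eigenvalue \<open>n - 2t - 3 = -b\<close>, and larger sizes have eigenvalues at
  most \<open>-b\<close>. So \<open>-b\<close> bounds every eigenvalue that the non-constant part of \<open>f\<close> uses.

  The prescribed size \<open>N\<close> says exactly that \<open>h = B f + b f - b\<close> has mean zero. The bound on the
  eigenvalues then gives \<open>\<langle>f, h\<rangle> \<le> 0\<close> by Parseval, term by term. On the other hand
  \<open>\<langle>f, h\<rangle> = \<langle>f, B f\<rangle> + b (\<langle>f, f\<rangle> - \<langle>f, 1\<rangle>) \<ge> 0\<close>, because \<open>f\<close> takes values in the natural
  numbers. Hence all terms of the Parseval sum are zero, and this forces \<open>h = 0\<close>
  (lemma \<open>folded_adjacency_of_density_bound_equality\<close>):

  \<open>(\<Sum>i<n. f (x + e_i)) + f (x + \<bar>1) = b (1 - f x)\<close> for every word \<open>x\<close>.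

  If \<open>b = 0\<close> then \<open>N = 0\<close>; if \<open>b > 0\<close> then \<open>f \<le> 1\<close>, since the left side is nonnegative. In both
  cases \<open>C\<close> is a set. For \<open>x \<in> C\<close> the left side is zero:
  \<open>C\<close> is independent and disjoint from \<open>C'\<close>. A word outside \<open>C\<close> has \<open>b\<close> folded neighbours in
  \<open>C\<close>, one of which is its complement precisely when the word lies in \<open>C'\<close>; this gives \<open>a\<close> cube
  neighbours in \<open>C\<close> for words of \<open>C'\<close> and \<open>a + 1\<close> for words of \<open>C''\<close>. Complementation is an
  automorphism of the cube that exchanges \<open>C\<close> and \<open>C'\<close>, so it gives the counts into \<open>C'\<close>, and the
  counts into \<open>C''\<close> follow because the cube has degree \<open>n\<close>.
\<close>

section \<open>Translations of the cube\<close>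

lemma bit_vec_add_self:
  assumes "z \<in> carrier_vec n"
  shows "z + z = (0\<^sub>v n :: bit vec)"
  using assms by (intro eq_vecI) auto

lemma sum_carrier_translate:
  fixes F :: "bit vec \<Rightarrow> real"
  assumes z: "z \<in> carrier_vec n"
  shows "(\<Sum>x\<in>carrier_vec n. F (x + z)) = (\<Sum>x\<in>carrier_vec n. F x)"
  by (rule sum.reindex_bij_witness[where i = "\<lambda>x. x + z" and j = "\<lambda>x. x + z"])
    (use z in \<open>auto simp: bit_vec_add_self[where n = n]\<close>)

lemma all_one_carrier [simp]: "all_one n \<in> carrier_vec n"
  by (simp add: all_one_def)

lemma all_one_index [simp]: "i < n \<Longrightarrow> all_one n $ i = 1"
  by (simp add: all_one_def)

section \<open>Walsh functions\<close>

definition bit_sign :: "bit \<Rightarrow> real" where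
  "bit_sign b = (if b = 0 then 1 else -1)"

lemma bit_sign_add: "bit_sign (a + b) = bit_sign a * bit_sign b"
  by (cases a; cases b) (auto simp: bit_sign_def)

lemma bit_sign_simps [simp]: "bit_sign 0 = 1" "bit_sign 1 = -1"
  by (auto simp: bit_sign_def)

definition walsh :: "nat set \<Rightarrow> bit vec \<Rightarrow> real" where
  "walsh S x = (\<Prod>i\<in>S. bit_sign (x $ i))"

definition walsh_transform :: "nat \<Rightarrow> (bit vec \<Rightarrow> real) \<Rightarrow> nat set \<Rightarrow> real" where
  "walsh_transform n f S = (\<Sum>x\<in>carrier_vec n. f x * walsh S x)"

lemma walsh_empty [simp]: "walsh {} x = 1"
  by (simp add: walsh_def)

lemma walsh_add:
  assumes "S \<subseteq> {..<n}" "x \<in> carrier_vec n" "y \<in> carrier_vec n"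
  shows "walsh S (x + y) = walsh S x * walsh S y"
proof -
  have "walsh S (x + y) = (\<Prod>i\<in>S. bit_sign (x $ i) * bit_sign (y $ i))"
    unfolding walsh_def using assms by (intro prod.cong) (auto simp: bit_sign_add subset_iff)
  then show ?thesis by (simp add: walsh_def prod.distrib)
qed

lemma walsh_unit_vec:
  assumes "S \<subseteq> {..<n}" "i < n"
  shows "walsh S (unit_vec n i) = (if i \<in> S then -1 else 1)"
proof -
  have "walsh S (unit_vec n i) = (\<Prod>j\<in>S. if j = i then -1 else 1)"
    unfolding walsh_def using assms by (intro prod.cong) auto
  also have "\<dots> = (if i \<in> S then -1 else 1)"
    using assms finite_subset[of S "{..<n}"] by (subst prod.delta) auto
  finally show ?thesis .
qed

lemma walsh_all_one:
  assumes "S \<subseteq> {..<n}"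
  shows "walsh S (all_one n) = (-1) ^ card S"
proof -
  have "walsh S (all_one n) = (\<Prod>j\<in>S. -1)"
    unfolding walsh_def using assms by (intro prod.cong) auto
  then show ?thesis by simp
qed

text \<open>
  The folded adjacency operator is a sum of translations, so this one rule supplies its
  eigenvalues and also, with a translation by a unit vector that \<open>walsh S\<close> negates, the
  vanishing of the transform of a constant.
\<close>

lemma walsh_transform_translate:
  assumes S: "S \<subseteq> {..<n}" and z: "z \<in> carrier_vec n"
  shows "walsh_transform n (\<lambda>x. f (x + z)) S = walsh S z * walsh_transform n f S"
proof -
  have "walsh_transform n (\<lambda>x. f (x + z)) S
      = (\<Sum>x\<in>carrier_vec n. f (x + z) * walsh S (x + z + z))"
    unfolding walsh_transform_def
    by (intro sum.cong refl) (use z in \<open>auto simp: bit_vec_add_self[where n = n]\<close>)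
  also have "\<dots> = (\<Sum>x\<in>carrier_vec n. f x * walsh S (x + z))"
    by (rule sum_carrier_translate[OF z, of "\<lambda>x. f x * walsh S (x + z)"])
  also have "\<dots> = (\<Sum>x\<in>carrier_vec n. walsh S z * (f x * walsh S x))"
    by (intro sum.cong refl) (use S z in \<open>auto simp: walsh_add[where n = n]\<close>)
  finally show ?thesis by (simp add: walsh_transform_def sum_distrib_left)
qed

lemma walsh_transform_const:
  assumes S: "S \<subseteq> {..<n}" and ne: "S \<noteq> {}"
  shows "walsh_transform n (\<lambda>_. c) S = 0"
proof -
  obtain i where i: "i \<in> S" using ne by auto
  with S have "i < n" by auto
  then have "walsh S (unit_vec n i) = -1" using walsh_unit_vec[OF S] i by simp
  with walsh_transform_translate[OF S, of "unit_vec n i" "\<lambda>_. c"] show ?thesis by simp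
qed

text \<open>
  Summing over the index \<open>S\<close> rather than over the words makes the sum factor over the
  coordinates, and a single coordinate in which \<open>x\<close> and \<open>y\<close> differ contributes the factor
  \<open>1 - 1\<close>. This is the half of the orthogonality relations from which Parseval's identity follows.
\<close>

lemma walsh_dual_orthogonality:
  assumes x: "x \<in> carrier_vec n" and y: "y \<in> carrier_vec n"
  shows "(\<Sum>S\<in>Pow {..<n}. walsh S x * walsh S y) = (if x = y then 2 ^ n else 0)"
proof -
  have "(\<Sum>S\<in>Pow {..<n}. walsh S x * walsh S y)
      = (\<Prod>i<n. bit_sign (x $ i) * bit_sign (y $ i) + 1)"
    by (subst prod_add) (auto simp: walsh_def prod.distrib)
  also have "\<dots> = (if x = y then 2 ^ n else 0)"
  proof (cases "x = y")
    case True
    have "bit_sign b * bit_sign b + 1 = 2" for b by (cases b) auto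
    then show ?thesis using True by simp
  next
    case False
    then obtain i where "i < n" "x $ i \<noteq> y $ i" using x y by (metis carrier_vecD eq_vecI)
    moreover from this have "bit_sign (x $ i) * bit_sign (y $ i) + 1 = 0"
      by (cases "x $ i"; cases "y $ i") auto
    ultimately show ?thesis using False by (auto intro!: prod_zero)
  qed
  finally show ?thesis .
qed

lemma walsh_parseval:
  "(\<Sum>S\<in>Pow {..<n}. walsh_transform n f S * walsh_transform n g S)
     = 2 ^ n * (\<Sum>x\<in>carrier_vec n. f x * g x)"
proof -
  have "(\<Sum>S\<in>Pow {..<n}. walsh_transform n f S * walsh_transform n g S)
      = (\<Sum>S\<in>Pow {..<n}. \<Sum>x\<in>carrier_vec n. \<Sum>y\<in>carrier_vec n.
           f x * g y * (walsh S x * walsh S y))"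
    unfolding walsh_transform_def sum_product by (simp add: mult_ac)
  also have "\<dots> = (\<Sum>x\<in>carrier_vec n. \<Sum>y\<in>carrier_vec n. \<Sum>S\<in>Pow {..<n}.
           f x * g y * (walsh S x * walsh S y))"
    by (subst sum.swap, intro sum.cong refl, subst sum.swap, rule refl)
  also have "\<dots> = (\<Sum>x\<in>carrier_vec n. \<Sum>y\<in>carrier_vec n.
           if x = y then f x * g y * 2 ^ n else 0)"
    by (intro sum.cong refl) (simp add: walsh_dual_orthogonality flip: sum_distrib_left)
  also have "\<dots> = (\<Sum>x\<in>carrier_vec n. f x * g x * 2 ^ n)"
    by (intro sum.cong refl) (simp add: sum.delta' finite_carrier_vec_bit)
  finally show ?thesis by (simp add: sum_distrib_left mult_ac)
qed

lemma walsh_transform_eq_0D: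
  assumes "\<And>S. S \<subseteq> {..<n} \<Longrightarrow> walsh_transform n h S = 0" and x: "x \<in> carrier_vec n"
  shows "h x = 0"
proof -
  have "(\<Sum>x\<in>carrier_vec n. h x * h x) = 0"
    using walsh_parseval[of n h h] assms(1) by simp
  then show ?thesis
    using x by (subst (asm) sum_nonneg_eq_0_iff) (auto simp: finite_carrier_vec_bit)
qed

lemma card_carrier_vec_bit: "real (card (carrier_vec n :: bit vec set)) = 2 ^ n"
proof -
  let ?one = "\<lambda>_ :: bit vec. 1 :: real"
  let ?c = "real (card (carrier_vec n :: bit vec set))"
  have "2 ^ n * ?c = (\<Sum>S\<in>Pow {..<n}. walsh_transform n ?one S * walsh_transform n ?one S)"
    using walsh_parseval[of n ?one ?one] by simp
  also have "\<dots> = (\<Sum>S\<in>Pow {..<n}. if S = {} then ?c * ?c else 0)"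
    by (intro sum.cong refl) (auto simp: walsh_transform_const, simp add: walsh_transform_def)
  also have "\<dots> = ?c * ?c"
    by (simp add: sum.delta')
  finally have "2 ^ n * ?c = ?c * ?c" .
  moreover have "(carrier_vec n :: bit vec set) \<noteq> {}" using zero_carrier_vec by blast
  then have "?c \<noteq> 0" by (simp add: finite_carrier_vec_bit)
  ultimately show ?thesis by (metis mult_cancel_right)
qed

section \<open>The folded cube\<close>

text \<open>
  For \<open>n \<ge> 2\<close> this is the adjacency operator of the folded \<open>(n+1)\<close>-cube: identifying antipodal
  words of length \<open>n + 1\<close> leaves the words of length \<open>n\<close>, and flipping the lost coordinate
  becomes complementation.
\<close>

definition folded_adjacency :: "nat \<Rightarrow> (bit vec \<Rightarrow> real) \<Rightarrow> bit vec \<Rightarrow> real" where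
  "folded_adjacency n f x = (\<Sum>i<n. f (x + unit_vec n i)) + f (x + all_one n)"

lemma walsh_transform_folded_adjacency:
  assumes S: "S \<subseteq> {..<n}"
  shows "walsh_transform n (folded_adjacency n f) S
           = (real n - 2 * real (card S) + (-1) ^ card S) * walsh_transform n f S"
proof -
  have "walsh_transform n (folded_adjacency n f) S
      = (\<Sum>i<n. walsh_transform n (\<lambda>x. f (x + unit_vec n i)) S)
        + walsh_transform n (\<lambda>x. f (x + all_one n)) S"
    unfolding walsh_transform_def folded_adjacency_def
    by (subst sum.swap) (simp add: sum.distrib distrib_right sum_distrib_right)
  also have "\<dots> = ((\<Sum>i<n. if i \<in> S then -1 else 1) + (-1) ^ card S) * walsh_transform n f S"
    using S by (simp add: walsh_transform_translate walsh_unit_vec walsh_all_one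
        distrib_right sum_distrib_right)
  also have "(\<Sum>i<n. if i \<in> S then -1 else 1 :: real) = real n - 2 * real (card S)"
  proof -
    have "(\<Sum>i<n. if i \<in> S then -1 else 1 :: real) = (\<Sum>i<n. 1 - 2 * (if i \<in> S then 1 else 0))"
      by (intro sum.cong) auto
    also have "\<dots> = real n - 2 * real (card ({..<n} \<inter> S))"
      by (simp add: sum_subtractf sum.If_cases flip: sum_distrib_left)
    finally show ?thesis using S by (simp add: Int_absorb1)
  qed
  finally show ?thesis .
qed

section \<open>Orthogonal arrays\<close>

lemma size_filter_mset_eq_sum:
  assumes "set_mset C \<subseteq> carrier_vec n"
  shows "real (size (filter_mset P C))
           = (\<Sum>x\<in>carrier_vec n. real (count C x) * of_bool (P (x :: bit vec)))"
proof -
  have "size (filter_mset P C) = (\<Sum>x\<in>carrier_vec n. count (filter_mset P C) x)"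
    unfolding size_multiset_overloaded_eq
    by (rule sum.mono_neutral_left)
      (use assms in \<open>auto simp: finite_carrier_vec_bit not_in_iff\<close>)
  then show ?thesis by (auto intro!: sum.cong)
qed

text \<open>
  A Walsh function that depends only on the coordinates in \<open>I\<close> is constant on the subcubes
  obtained by fixing them. An array that is equidistributed over these subcubes therefore gives
  it the same mean value as the uniform distribution on the cube, namely zero.
\<close>

lemma orthogonal_array_walsh_transform:
  assumes OA: "orthogonal_array N n t C"
    and S: "S \<subseteq> {..<n}" "S \<noteq> {}" "card S \<le> t"
  shows "walsh_transform n (\<lambda>x. real (count C x)) S = 0"
proof -
  let ?V = "carrier_vec n :: bit vec set"
  have "t \<le> n" and sub: "set_mset C \<subseteq> ?V" using OA by (auto simp: orthogonal_array_def)
  obtain I where I: "S \<subseteq> I" "I \<subseteq> {..<n}" "card I = t"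
    using exists_subset_between[of S t "{..<n}"] S \<open>t \<le> n\<close> by auto
  define agree :: "bit vec \<Rightarrow> bit vec \<Rightarrow> bool" where "agree x y \<longleftrightarrow> (\<forall>i\<in>I. x $ i = y $ i)" for x y
  have cnt: "(\<Sum>x\<in>?V. real (count C x) * of_bool (agree x y)) = real N / 2 ^ t" for y
  proof -
    have "(\<Sum>x\<in>?V. real (count C x) * of_bool (agree x y))
        = (\<Sum>x\<in>?V. real (count C x) * of_bool (x \<in> subcube n I (\<lambda>i. y $ i)))"
      by (intro sum.cong) (auto simp: subcube_def agree_def)
    also have "\<dots> = real N / 2 ^ t"
      using OA I unfolding size_filter_mset_eq_sum[OF sub, symmetric] orthogonal_array_def by blast
    finally show ?thesis .
  qed
  define K where "K = (\<Sum>y\<in>?V. of_bool (agree (0\<^sub>v n) y) :: real)"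
  have K: "(\<Sum>y\<in>?V. of_bool (agree x y)) = K" if x: "x \<in> ?V" for x
  proof -
    have "(\<Sum>y\<in>?V. of_bool (agree x y) :: real) = (\<Sum>y\<in>?V. of_bool (agree x (y + x)))"
      by (rule sum_carrier_translate[OF x, symmetric])
    also have "\<dots> = K" unfolding K_def
      by (intro sum.cong refl) (use x I in \<open>auto simp: agree_def subset_eq\<close>)
    finally show ?thesis .
  qed
  have "K > 0" unfolding K_def
    by (rule sum_pos2[where i = "0\<^sub>v n"]) (auto simp: finite_carrier_vec_bit agree_def)
  \<comment> \<open>Weighting each word by the size \<open>K\<close> of its subcube allows the sum over \<open>C\<close> to be spread
      evenly over all words \<open>y\<close> that agree with an element of \<open>C\<close>.\<close>
  have "K * walsh_transform n (\<lambda>x. real (count C x)) S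
      = (\<Sum>x\<in>?V. real (count C x) * walsh S x * (\<Sum>y\<in>?V. of_bool (agree x y)))"
    by (simp add: walsh_transform_def K sum_distrib_left mult_ac)
  also have "\<dots> = (\<Sum>x\<in>?V. \<Sum>y\<in>?V. walsh S y * (real (count C x) * of_bool (agree x y)))"
  proof -
    have "walsh S x = walsh S y" if "agree x y" for x y
      using that I unfolding walsh_def agree_def by (intro prod.cong) auto
    then have "real (count C x) * walsh S x * of_bool (agree x y)
        = walsh S y * (real (count C x) * of_bool (agree x y))" for x y
      by (cases "agree x y") auto
    then show ?thesis unfolding sum_distrib_left by (intro sum.cong refl)
  qed
  also have "\<dots> = (\<Sum>y\<in>?V. walsh S y * (\<Sum>x\<in>?V. real (count C x) * of_bool (agree x y)))"
    by (subst sum.swap) (simp add: sum_distrib_left)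
  also have "\<dots> = walsh_transform n (\<lambda>_. real N / 2 ^ t) S"
    by (simp add: cnt walsh_transform_def mult.commute)
  also have "\<dots> = 0" by (rule walsh_transform_const[OF S(1,2)])
  finally show ?thesis using \<open>K > 0\<close> by simp
qed

section \<open>Equality in the density bound\<close>

text \<open>
  The inner product \<open>\<langle>f, B f\<rangle>\<close> is nonnegative, but the assumption on the eigenvalues pushes it
  down unless the constant part of \<open>f\<close> is large; \<open>total\<close> says that the density \<open>b / (n + 1 + b)\<close>
  is the least that balances the two, so nothing may be lost in either estimate. The assumption
  \<open>sq\<close> is what remains of integrality. The eigenvalues are restricted only where \<open>f\<close> has a
  nonzero coefficient, since the strength of an array controls just these.
\<close>

lemma folded_adjacency_of_density_bound_equality:
  fixes f :: "bit vec \<Rightarrow> real"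
  assumes nonneg: "\<And>x. x \<in> carrier_vec n \<Longrightarrow> f x \<ge> 0"
    and sq: "\<And>x. x \<in> carrier_vec n \<Longrightarrow> f x \<le> f x * f x"
    and b: "b \<ge> 0"
    and total: "(real n + 1 + b) * (\<Sum>x\<in>carrier_vec n. f x) = b * 2 ^ n"
    and gap: "\<And>S. S \<subseteq> {..<n} \<Longrightarrow> S \<noteq> {} \<Longrightarrow> walsh_transform n f S \<noteq> 0 \<Longrightarrow>
                real n - 2 * real (card S) + (-1) ^ card S \<le> -b"
    and x: "x \<in> carrier_vec n"
  shows "folded_adjacency n f x = b * (1 - f x)"
proof -
  let ?V = "carrier_vec n :: bit vec set"
  let ?f = "walsh_transform n f"
  define ev where "ev S = real n - 2 * real (card S) + (-1) ^ card S" for S :: "nat set"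
  \<comment> \<open>The claim is \<open>h = 0\<close>.\<close>
  define h where "h = (\<lambda>x. folded_adjacency n f x + b * f x - b)"
  have h_lin: "walsh_transform n h S = walsh_transform n (folded_adjacency n f) S + b * ?f S
      - walsh_transform n (\<lambda>_. b) S" for S
    by (simp add: h_def walsh_transform_def algebra_simps sum.distrib sum_subtractf sum_distrib_left)
  have h_ne: "walsh_transform n h S = (ev S + b) * ?f S" if "S \<subseteq> {..<n}" "S \<noteq> {}" for S
    unfolding h_lin using that
    by (simp add: walsh_transform_folded_adjacency walsh_transform_const ev_def algebra_simps)
  have card_V: "real (card ?V) = 2 ^ n"
    by (rule card_carrier_vec_bit)
  have h_empty: "walsh_transform n h {} = 0"
    unfolding h_lin walsh_transform_folded_adjacency[OF empty_subsetI]
    using total card_V by (simp add: walsh_transform_def algebra_simps)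
  have le: "?f S * walsh_transform n h S \<le> 0" if S: "S \<in> Pow {..<n}" for S
  proof (cases "S = {} \<or> ?f S = 0")
    case True
    then show ?thesis using h_empty by auto
  next
    case False
    then have "ev S + b \<le> 0" using gap[of S] S by (auto simp: ev_def)
    then have "(ev S + b) * (?f S * ?f S) \<le> 0" by (intro mult_nonpos_nonneg) auto
    then show ?thesis using S False h_ne[of S] by (simp add: mult_ac)
  qed
  have "0 \<le> f x * h x" if x: "x \<in> ?V" for x
  proof -
    have "0 \<le> folded_adjacency n f x"
      unfolding folded_adjacency_def using x by (intro add_nonneg_nonneg sum_nonneg nonneg) auto
    then have "0 \<le> f x * folded_adjacency n f x + b * (f x * f x - f x)"
      using nonneg[OF x] sq[OF x] b by (intro add_nonneg_nonneg mult_nonneg_nonneg) auto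
    then show ?thesis by (simp add: h_def algebra_simps)
  qed
  then have "0 \<le> (\<Sum>S\<in>Pow {..<n}. ?f S * walsh_transform n h S)"
    unfolding walsh_parseval by (simp add: sum_nonneg)
  then have "(\<Sum>S\<in>Pow {..<n}. - (?f S * walsh_transform n h S)) = 0"
    using le sum_nonpos[of "Pow {..<n}" "\<lambda>S. ?f S * walsh_transform n h S"]
    by (simp add: sum_negf)
  then have zero: "\<forall>S\<in>Pow {..<n}. - (?f S * walsh_transform n h S) = 0"
    by (subst (asm) sum_nonneg_eq_0_iff) (use le in auto)
  \<comment> \<open>For nonempty \<open>S\<close> the coefficient of \<open>h\<close> is a multiple of that of \<open>f\<close>, so if their product
      is zero then the coefficient of \<open>h\<close> is zero.\<close>
  have "walsh_transform n h S = 0" if S: "S \<subseteq> {..<n}" for S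
    using zero[rule_format, of S] S h_empty h_ne[of S] by (cases "S = {}") auto
  then have "h x = 0" using x by (rule walsh_transform_eq_0D)
  then show ?thesis by (simp add: h_def algebra_simps)
qed

lemma orthogonal_array_folded_adjacency:
  assumes t: "even t"
    and OA: "orthogonal_array N n t C"
    and N: "real N = 2 ^ n * (1 - (real n + 1) / (2 * (real t + 2)))"
    and x: "x \<in> carrier_vec n"
  shows "folded_adjacency n (\<lambda>x. real (count C x)) x
           = (2 * real t - real n + 3) * (1 - real (count C x))"
proof (rule folded_adjacency_of_density_bound_equality[OF _ _ _ _ _ x])
  have sub: "set_mset C \<subseteq> carrier_vec n" and N_size: "size C = N"
    using OA by (auto simp: orthogonal_array_def)
  have "(\<Sum>x\<in>carrier_vec n. real (count C x)) = real N"
    using size_filter_mset_eq_sum[OF sub, of "\<lambda>_. True"] N_size by simp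
  moreover have N': "(2 * real t + 4) * real N = (2 * real t - real n + 3) * 2 ^ n"
    using N by (simp add: field_simps)
  ultimately show "(real n + 1 + (2 * real t - real n + 3)) *
      (\<Sum>x\<in>carrier_vec n. real (count C x)) = (2 * real t - real n + 3) * 2 ^ n"
    by (simp add: add.commute)
  \<comment> \<open>The size formula makes \<open>b\<close> a positive multiple of \<open>N\<close>, whence its sign.\<close>
  have "0 \<le> (2 * real t - real n + 3) * 2 ^ n" unfolding N'[symmetric] by simp
  moreover have "(0 :: real) < 2 ^ n" by simp
  ultimately show "0 \<le> 2 * real t - real n + 3" unfolding zero_le_mult_iff by linarith
  show "real (count C x) \<le> real (count C x) * real (count C x)" for x
    by (cases "count C x") (auto simp: algebra_simps)
  fix S assume S: "S \<subseteq> {..<n}" "S \<noteq> {}" "walsh_transform n (\<lambda>x. real (count C x)) S \<noteq> 0"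
  then have ge: "card S \<ge> Suc t"
    using orthogonal_array_walsh_transform[OF OA S(1,2)] by linarith
  show "real n - 2 * real (card S) + (-1) ^ card S \<le> - (2 * real t - real n + 3)"
  proof (cases "even (card S)")
    case True
    \<comment> \<open>An even size gains 1 from the complementation term, which would break the bound at
        \<open>t + 1\<close>; that size is odd because \<open>t\<close> is even.\<close>
    with t ge have "card S \<noteq> Suc t" by auto
    with ge have "card S \<ge> t + 2" by simp
    then show ?thesis using True by simp
  next
    case False
    then show ?thesis using ge by simp
  qed
qed auto

section \<open>The equitable partition\<close>

lemma add_unit_vec_diff:
  fixes v :: "bit vec"
  assumes v: "v \<in> carrier_vec n" and i: "i < n"
  shows "{j. j < n \<and> v $ j \<noteq> (v + unit_vec n i) $ j} = {i}"
proof -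
  have "v $ j \<noteq> (v + unit_vec n i) $ j \<longleftrightarrow> j = i" if "j < n" for j
    using i that by (cases "v $ j") (auto simp: index_unit_vec)
  then show ?thesis using i by blast
qed

lemma card_cube_neighbours:
  assumes v: "v \<in> carrier_vec n" and D: "D \<subseteq> carrier_vec n"
  shows "card {w \<in> D. (v, w) \<in> parcs (cube n)} = card {i. i < n \<and> v + unit_vec n i \<in> D}"
proof -
  have "{w \<in> D. (v, w) \<in> parcs (cube n)}
      = (\<lambda>i. v + unit_vec n i) ` {i. i < n \<and> v + unit_vec n i \<in> D}"
  proof (intro equalityI subsetI)
    fix w assume "w \<in> {w \<in> D. (v, w) \<in> parcs (cube n)}"
    then have w: "w \<in> D" "w \<in> carrier_vec n" and "card {i. i < n \<and> v $ i \<noteq> w $ i} = 1"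
      by (auto simp: cube_def)
    then obtain i where i: "{i. i < n \<and> v $ i \<noteq> w $ i} = {i}" by (auto simp: card_1_singleton_iff)
    then have "i < n" by auto
    have "w = v + unit_vec n i"
    proof (rule eq_vecI)
      fix j assume "j < dim_vec (v + unit_vec n i)"
      then have j: "j < n" by simp
      show "w $ j = (v + unit_vec n i) $ j"
      proof (cases "j = i")
        case True
        have "v $ i \<noteq> w $ i" using i by auto
        then show ?thesis using True \<open>i < n\<close> by (cases "v $ i"; cases "w $ i") auto
      next
        case False
        then have "v $ j = w $ j" using i j by blast
        then show ?thesis using False j \<open>i < n\<close> by simp
      qed
    qed (use w in auto)
    then show "w \<in> (\<lambda>i. v + unit_vec n i) ` {i. i < n \<and> v + unit_vec n i \<in> D}"
      using w \<open>i < n\<close> by auto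
  next
    fix w assume "w \<in> (\<lambda>i. v + unit_vec n i) ` {i. i < n \<and> v + unit_vec n i \<in> D}"
    then obtain i where "i < n" "w = v + unit_vec n i" "w \<in> D" by auto
    then show "w \<in> {w \<in> D. (v, w) \<in> parcs (cube n)}"
      using v by (simp add: cube_def add_unit_vec_diff)
  qed
  moreover have "inj_on (\<lambda>i. v + unit_vec n i) {i. i < n \<and> v + unit_vec n i \<in> D}"
  proof (rule inj_onI)
    fix i j
    assume "i \<in> {i. i < n \<and> v + unit_vec n i \<in> D}" "j \<in> {i. i < n \<and> v + unit_vec n i \<in> D}"
    then have ij: "i < n" "j < n" by auto
    assume eq: "v + unit_vec n i = v + unit_vec n j"
    have "{i} = {k. k < n \<and> v $ k \<noteq> (v + unit_vec n i) $ k}"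
      by (rule add_unit_vec_diff[OF v ij(1), symmetric])
    also have "\<dots> = {j}" unfolding eq by (rule add_unit_vec_diff[OF v ij(2)])
    finally have "{i} = {j}" .
    then show "i = j" by simp
  qed
  ultimately show ?thesis by (simp add: card_image)
qed

text \<open>
  The folded-cube identity in the form of a count: once multiplicities are known to be at most 1,
  the sum over the neighbours is a cardinality and the identity holds among integers.
\<close>

lemma
  fixes C :: "bit vec multiset"
  assumes t: "even t"
    and OA: "orthogonal_array N n t C"
    and N: "real N = 2 ^ n * (1 - (real n + 1) / (2 * (real t + 2)))"
  shows orthogonal_array_count_le_1: "count C x \<le> 1"
    and orthogonal_array_neighbour_count: "v \<in> carrier_vec n \<Longrightarrow>
      int (card {i. i < n \<and> v + unit_vec n i \<in># C}) + of_bool (v + all_one n \<in># C)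
        = (2 * int t - int n + 3) * (1 - of_bool (v \<in># C))"
proof -
  have sub: "set_mset C \<subseteq> carrier_vec n" and N_size: "size C = N"
    using OA by (auto simp: orthogonal_array_def)
  note FA = orthogonal_array_folded_adjacency[OF t OA N]
  have N': "(2 * real t + 4) * real N = (2 * real t - real n + 3) * 2 ^ n"
    using N by (simp add: field_simps)
  show le_1: "count C x \<le> 1" for x
  proof (cases "x \<in># C")
    case True
    then have x: "x \<in> carrier_vec n" and "C \<noteq> {#}" using sub by auto
    then have "N > 0" using N_size nonempty_has_size by metis
    \<comment> \<open>The identity bounds \<open>count C x\<close> only for \<open>b > 0\<close>; if \<open>b = 0\<close> then \<open>N = 0\<close> and \<open>C\<close> is empty.\<close>
    then have "0 < (2 * real t - real n + 3) * 2 ^ n" unfolding N'[symmetric] by simp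
    then have b: "0 < 2 * real t - real n + 3" by (simp add: zero_less_mult_iff)
    have "0 \<le> folded_adjacency n (\<lambda>x. real (count C x)) x"
      unfolding folded_adjacency_def by (intro add_nonneg_nonneg sum_nonneg) auto
    then show ?thesis using b unfolding FA[OF x] by (simp add: zero_le_mult_iff)
  qed (simp add: not_in_iff)
  have f: "real (count C x) = of_bool (x \<in># C)" for x
    using le_1[of x] by (auto simp: le_Suc_eq simp flip: count_greater_zero_iff)
  assume v: "v \<in> carrier_vec n"
  have "{..<n} \<inter> {i. v + unit_vec n i \<in># C} = {i. i < n \<and> v + unit_vec n i \<in># C}" by auto
  then have "real_of_int (int (card {i. i < n \<and> v + unit_vec n i \<in># C}) + of_bool (v + all_one n \<in># C))
      = folded_adjacency n (\<lambda>x. real (count C x)) v"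
    by (simp add: folded_adjacency_def f)
  also have "\<dots> = real_of_int ((2 * int t - int n + 3) * (1 - of_bool (v \<in># C)))"
    using FA[OF v] by (simp add: f)
  finally show "int (card {i. i < n \<and> v + unit_vec n i \<in># C}) + of_bool (v + all_one n \<in># C)
        = (2 * int t - int n + 3) * (1 - of_bool (v \<in># C))"
    by (simp only: of_int_eq_iff)
qed

theorem theorem1:
  fixes t n N :: nat and C :: "bit vec multiset"
  assumes "even t"
    and "orthogonal_array N n t C"
    and "real N = 2 ^ n * (1 - (real n + 1) / (2 * (real t + 2)))"
  shows
    "let a = 2 * int t - int n + 2;
         C' = (\<lambda>c. c + all_one n) ` set_mset C;
         C'' = carrier_vec n - (set_mset C \<union> C');
         S = mat_of_rows_list 3
               [[0, 2 * int t - int n + 2, 2 * int n - 2 * int t - 2],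
                [2 * int t - int n + 2, 0, 2 * int n - 2 * int t - 2],
                [2 * int t - int n + 3, 2 * int t - int n + 3, 3 * int n - 4 * int t - 6]]
     in (\<forall>x. count C x \<le> 1) \<and>
        equitable_partition (cube n) [set_mset C, C', C''] S \<and>
        S = mat_of_rows_list 3
              [[0, a, int n - a],
               [a, 0, int n - a],
               [a + 1, a + 1, int n - 2 * a - 2]]"
proof -
  let ?V = "carrier_vec n :: bit vec set"
  define a where "a = 2 * int t - int n + 2"
  define C0 where "C0 = set_mset C"
  define C1 where "C1 = (\<lambda>c. c + all_one n) ` C0"
  define C2 where "C2 = ?V - (C0 \<union> C1)"
  define S where "S = mat_of_rows_list 3
      [[0, a, int n - a], [a, 0, int n - a], [a + 1, a + 1, int n - 2 * a - 2]]"
  define d where "d D v = int (card {i. i < n \<and> v + unit_vec n i \<in> D})" for D and v :: "bit vec"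
  have C0_sub: "C0 \<subseteq> ?V" using assms(2) by (simp add: orthogonal_array_def C0_def)
  then have C1_sub: "C1 \<subseteq> ?V" by (auto simp: C1_def)
  have mem_C1: "v \<in> C1 \<longleftrightarrow> v + all_one n \<in> C0" if "v \<in> ?V" for v
  proof
    assume "v \<in> C1"
    then show "v + all_one n \<in> C0"
      using C0_sub by (auto simp: C1_def bit_vec_add_self[where n = n] subset_iff)
  next
    assume "v + all_one n \<in> C0"
    then have "v + all_one n + all_one n \<in> C1" unfolding C1_def by (rule imageI)
    then show "v \<in> C1" using that by (simp add: bit_vec_add_self[where n = n])
  qed
  \<comment> \<open>The folded-cube identity, with the complementary neighbour recorded as membership in \<open>C1\<close>.\<close>
  have d0: "d C0 v + of_bool (v \<in> C1) = (a + 1) * (1 - of_bool (v \<in> C0))" if "v \<in> ?V" for v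
    using orthogonal_array_neighbour_count[OF assms that] that by (simp add: d_def a_def mem_C1 C0_def)
  have disj: "C0 \<inter> C1 = {}"
  proof -
    have False if "v \<in> C0" "v \<in> C1" for v
      using d0[of v] that C0_sub by (auto simp: d_def)
    then show ?thesis by auto
  qed
  have d1: "d C1 v = d C0 (v + all_one n)" if v: "v \<in> ?V" for v
  proof -
    have "v + unit_vec n i + all_one n = v + all_one n + unit_vec n i" for i
      using v by (simp add: assoc_add_vec[of _ n] comm_add_vec[of "unit_vec n i" n "all_one n"])
    then have "v + unit_vec n i \<in> C1 \<longleftrightarrow> v + all_one n + unit_vec n i \<in> C0" for i
      using v mem_C1[of "v + unit_vec n i"] by simp
    then show ?thesis by (simp add: d_def)
  qed
  have d1': "d C1 v + of_bool (v \<in> C0) = (a + 1) * (1 - of_bool (v \<in> C1))" if v: "v \<in> ?V" for v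
    using d0[of "v + all_one n"] v by (simp add: d1 mem_C1 bit_vec_add_self[where n = n])
  have d2: "d C0 v + d C1 v + d C2 v = int n" if v: "v \<in> ?V" for v
  proof -
    let ?I = "\<lambda>D. {i. i < n \<and> v + unit_vec n i \<in> D}"
    have "{..<n} = ?I C0 \<union> ?I C1 \<union> ?I C2" using v by (auto simp: C2_def)
    moreover have "card (?I C0 \<union> ?I C1 \<union> ?I C2) = card (?I C0) + card (?I C1) + card (?I C2)"
      using disj by (subst card_Un_disjoint; (subst card_Un_disjoint)?) (auto simp: C2_def)
    ultimately have "card {..<n} = card (?I C0) + card (?I C1) + card (?I C2)" by simp
    then show ?thesis by (simp add: d_def)
  qed
  have "equitable_partition (cube n) [C0, C1, C2] S"
    unfolding equitable_partition_def
  proof (intro conjI)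
    show "S \<in> carrier_mat (length [C0, C1, C2]) (length [C0, C1, C2])"
      by (simp add: S_def mat_of_rows_list_def numeral_3_eq_3)
    show "(\<Union>i<length [C0, C1, C2]. [C0, C1, C2] ! i) = pverts (cube n)"
      using C0_sub C1_sub by (auto simp: cube_def C2_def lessThan_Suc numeral_3_eq_3)
    show "disjoint_family_on (\<lambda>i. [C0, C1, C2] ! i) {..<length [C0, C1, C2]}"
      using disj unfolding disjoint_iff
      by (auto simp: disjoint_family_on_def C2_def less_Suc_eq)
    have nb: "int (card {w \<in> D. (v, w) \<in> parcs (cube n)}) = d D v" if "v \<in> ?V" "D \<subseteq> ?V" for v D
      using card_cube_neighbours[OF that] by (simp add: d_def)
    have row0: "d C0 v = 0 \<and> d C1 v = a \<and> d C2 v = int n - a" if v: "v \<in> C0" for v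
    proof -
      have "v \<in> ?V" and *: "v \<in> C0" "v \<notin> C1" using v C0_sub disj by auto
      then show ?thesis using d0[of v] d1'[of v] d2[of v] * by simp
    qed
    have row1: "d C0 v = a \<and> d C1 v = 0 \<and> d C2 v = int n - a" if v: "v \<in> C1" for v
    proof -
      have "v \<in> ?V" and *: "v \<in> C1" "v \<notin> C0" using v C1_sub disj by auto
      then show ?thesis using d0[of v] d1'[of v] d2[of v] * by simp
    qed
    have row2: "d C0 v = a + 1 \<and> d C1 v = a + 1 \<and> d C2 v = int n - 2 * a - 2" if v: "v \<in> C2" for v
    proof -
      have "v \<in> ?V" and *: "v \<notin> C0" "v \<notin> C1" using v by (auto simp: C2_def)
      then show ?thesis using d0[of v] d1'[of v] d2[of v] * by simp
    qed
    have C2_sub: "C2 \<subseteq> ?V" by (auto simp: C2_def)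
    show "\<forall>i<length [C0, C1, C2]. \<forall>j<length [C0, C1, C2]. \<forall>v\<in>[C0, C1, C2] ! i.
        int (card {w \<in> [C0, C1, C2] ! j. (v, w) \<in> parcs (cube n)}) = S $$ (i, j)"
    proof (intro allI impI ballI)
      fix i j v
      assume i: "i < length [C0, C1, C2]" and j: "j < length [C0, C1, C2]"
        and v: "v \<in> [C0, C1, C2] ! i"
      have i3: "i = 0 \<or> i = 1 \<or> i = 2" and j3: "j = 0 \<or> j = 1 \<or> j = 2"
        using i j by auto
      have "v \<in> ?V" using i3 v C0_sub C1_sub C2_sub by auto
      moreover have "[C0, C1, C2] ! j \<subseteq> ?V" using j3 C0_sub C1_sub C2_sub by auto
      ultimately have "int (card {w \<in> [C0, C1, C2] ! j. (v, w) \<in> parcs (cube n)}) = d ([C0, C1, C2] ! j) v"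
        by (rule nb)
      also have "\<dots> = S $$ (i, j)"
        using i3
      proof (elim disjE)
        assume i: "i = 0"
        with v have "v \<in> C0" by simp
        from row0[OF this] i j3 show ?thesis by (auto simp: S_def mat_of_rows_list_def)
      next
        assume i: "i = 1"
        with v have "v \<in> C1" by simp
        from row1[OF this] i j3 show ?thesis by (auto simp: S_def mat_of_rows_list_def)
      next
        assume i: "i = 2"
        with v have "v \<in> C2" by simp
        from row2[OF this] i j3 show ?thesis by (auto simp: S_def mat_of_rows_list_def)
      qed
      finally show "int (card {w \<in> [C0, C1, C2] ! j. (v, w) \<in> parcs (cube n)}) = S $$ (i, j)" .
    qed
  qed
  moreover have S_eq: "S = mat_of_rows_list 3
      [[0, 2 * int t - int n + 2, 2 * int n - 2 * int t - 2],
       [2 * int t - int n + 2, 0, 2 * int n - 2 * int t - 2],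
       [2 * int t - int n + 3, 2 * int t - int n + 3, 3 * int n - 4 * int t - 6]]"
  proof -
    have "int n - a = 2 * int n - 2 * int t - 2" "a + 1 = 2 * int t - int n + 3"
      "int n - 2 * a - 2 = 3 * int n - 4 * int t - 6"
      by (simp_all add: a_def)
    then show ?thesis unfolding S_def by (simp only: a_def)
  qed
  ultimately show ?thesis
    unfolding Let_def a_def[symmetric] C0_def[symmetric] C1_def[symmetric] C2_def[symmetric]
      S_eq[unfolded a_def[symmetric], symmetric]
    using orthogonal_array_count_le_1[OF assms] S_def by blast
qed

end
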